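(* Let $d,k\ge 1$ be integers, let $u^1,\dots,u^k\in\mathbb{Z}^d$, and let $\alpha_1,\dots,\alpha_k\ge 0$ be real numbers. If $\sum_{i=1}^k\alpha_i\ge d$, then there exist real numbers $\beta_i\in[0,\alpha_i]$ for $i=1,\dots,k$ such that not all of $\beta_1,\dots,\beta_k$ are zero and $\sum_{i=1}^k\beta_i u^i\in\mathbb{Z}^d$.
   Context: Superscripts on $u^1,\dots,u^k$ are indices, not powers; the vectors need not be distinct. *)

theory Defs
  imports "HOL-Analysis.Analysis"
begin

definition int_vectors :: "(real ^ 'n) set" where
  "int_vectors = {x. \<forall>j. x $ j \<in> \<int>}"

end

theory Submission
  imports Defs "HOL-Number_Theory.Residues"
begin

text \<open>For a prime \<open>p\<close>, take \<open>\<lceil>p \<alpha>\<^sub>i\<rceil>\<close> copies of \<open>u\<^sub>i\<close>. These are at least \<open>d p > d (p - 1)\<close> vectors, so by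
  Olson's bound for the Davenport constant of \<open>(\<int>/p)\<^sup>d\<close> some nonempty subfamily has sum \<open>0\<close>
  modulo \<open>p\<close>; dividing its multiplicities by \<open>p\<close> gives coefficients \<open>\<beta>\<^sub>i \<le> \<alpha>\<^sub>i + 1/p\<close> with integral
  combination. If for some \<open>p\<close> this combination vanishes, scale the \<open>\<beta>\<^sub>i\<close> down. Otherwise all
  combinations have norm at least \<open>1\<close>, so a limit point for \<open>p \<rightarrow> \<infinity>\<close> is nonzero.\<close>

section \<open>Multilinear polynomials on subsets and their alternating sums\<close>

text \<open>Multilinear polynomials of degree at most \<open>m\<close> in the indicator variables of the elements of
  \<open>T\<close>.\<close>

inductive set_polynomial :: "'a set \<Rightarrow> nat \<Rightarrow> ('a set \<Rightarrow> int) \<Rightarrow> bool" for T where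
  monomial: "A \<subseteq> T \<Longrightarrow> card A \<le> m \<Longrightarrow> set_polynomial T m (\<lambda>S. c * of_bool (A \<subseteq> S))"
| add: "set_polynomial T m f \<Longrightarrow> set_polynomial T m g \<Longrightarrow> set_polynomial T m (\<lambda>S. f S + g S)"

lemma set_polynomial_const: "set_polynomial T m (\<lambda>S. c)"
  using monomial[of "{}" T m c] by simp

lemma set_polynomial_sum:
  assumes "\<And>x. x \<in> X \<Longrightarrow> set_polynomial T m (f x)"
  shows "set_polynomial T m (\<lambda>S. \<Sum>x\<in>X. f x S)"
  using assms
  by (induction X rule: infinite_finite_induct) (auto intro: set_polynomial_const add)

text \<open>Indicators are idempotent, so the monomials of \<open>A\<close> and \<open>B\<close>
  multiply to a multiple of the monomial of \<open>A \<union> B\<close>: the product stays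
  multilinear and the degree bounds add.\<close>

lemma set_polynomial_mult_monomial:
  assumes "set_polynomial T n g" "finite T" "A \<subseteq> T" "card A \<le> m"
  shows "set_polynomial T (m + n) (\<lambda>S. c * of_bool (A \<subseteq> S) * g S)"
  using assms(1)
proof induction
  case (monomial B n d)
  have "card (A \<union> B) \<le> m + n"
    using card_Un_le[of A B] assms(4) monomial by linarith
  then have "set_polynomial T (m + n) (\<lambda>S. (c * d) * of_bool (A \<union> B \<subseteq> S))"
    using assms monomial by (intro set_polynomial.monomial) auto
  moreover have "(\<lambda>S. (c * d) * of_bool (A \<union> B \<subseteq> S))
      = (\<lambda>S. c * of_bool (A \<subseteq> S) * (d * of_bool (B \<subseteq> S)))"
    by (auto simp: fun_eq_iff)
  ultimately show ?case by simp
next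
  case (add n f g)
  then show ?case
    using set_polynomial.add[OF add.IH] by (simp add: distrib_left)
qed

lemma set_polynomial_mult:
  assumes "set_polynomial T m f" "set_polynomial T n g" "finite T"
  shows "set_polynomial T (m + n) (\<lambda>S. f S * g S)"
  using assms(1)
proof induction
  case (monomial A m c)
  then show ?case using set_polynomial_mult_monomial assms by blast
next
  case (add m f h)
  then show ?case
    using set_polynomial.add[OF add.IH] by (simp add: distrib_right)
qed

lemma set_polynomial_power:
  assumes "set_polynomial T m f" "finite T"
  shows "set_polynomial T (n * m) (\<lambda>S. f S ^ n)"
  by (induction n) (auto intro: set_polynomial_const set_polynomial_mult assms)

lemma set_polynomial_prod:
  assumes "\<And>x. x \<in> X \<Longrightarrow> set_polynomial T m (f x)" "finite X" "finite T"
  shows "set_polynomial T (card X * m) (\<lambda>S. \<Prod>x\<in>X. f x S)"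
  using assms(2,1)
  by (induction X) (auto intro: set_polynomial_const set_polynomial_mult assms(3))

text \<open>Toggling a fixed element of \<open>T - A\<close> pairs the even sets between
  \<open>A\<close> and \<open>T\<close> with the odd ones.\<close>

lemma alternating_sum_supersets:
  assumes "finite T" "A \<subset> T"
  shows "(\<Sum>S | A \<subseteq> S \<and> S \<subseteq> T. (- 1) ^ card S) = (0 :: int)"
proof (rule sum_alternating_cancels)
  show "finite {S. A \<subseteq> S \<and> S \<subseteq> T}" using assms by simp
  show "card {S \<in> {S. A \<subseteq> S \<and> S \<subseteq> T}. even (card S)}
      = card {S \<in> {S. A \<subseteq> S \<and> S \<subseteq> T}. odd (card S)}"
    using card_subsupersets_even_odd[OF assms] by (simp add: conj_ac)
qed

text \<open>By linearity a single monomial suffices. Its set \<open>A\<close> is smaller than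
  \<open>T\<close>, hence a proper subset, and only the supersets of \<open>A\<close> contribute;
  their signs cancel.\<close>

lemma alternating_sum_set_polynomial:
  assumes "set_polynomial T m f" "finite T" "m < card T"
  shows "(\<Sum>S\<in>Pow T. (- 1) ^ card S * f S) = 0"
  using assms(1,3)
proof induction
  case (monomial A m c)
  then have "A \<subset> T" by auto
  have "(\<Sum>S\<in>Pow T. (- 1) ^ card S * (c * of_bool (A \<subseteq> S)))
      = (\<Sum>S\<in>Pow T. if A \<subseteq> S then c * (- 1) ^ card S else 0)"
    by (intro sum.cong) auto
  also have "\<dots> = (\<Sum>S\<in>{S \<in> Pow T. A \<subseteq> S}. c * (- 1) ^ card S)"
    using assms(2) by (subst sum.inter_filter) auto
  also have "{S \<in> Pow T. A \<subseteq> S} = {S. A \<subseteq> S \<and> S \<subseteq> T}" by auto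
  also have "(\<Sum>S | A \<subseteq> S \<and> S \<subseteq> T. c * (- 1) ^ card S) = 0"
    using alternating_sum_supersets[OF assms(2) \<open>A \<subset> T\<close>] by (simp flip: sum_distrib_left)
  finally show ?case .
next
  case (add m f g)
  then show ?case by (simp add: distrib_left sum.distrib)
qed

section \<open>Zero-sum subfamilies modulo a prime\<close>

lemma fermat_theorem_int:
  fixes a :: int
  assumes "prime p" "\<not> int p dvd a"
  shows "int p dvd 1 - a ^ (p - 1)"
proof -
  \<comment> \<open>Sums of coordinates may be negative; passing to the residue makes Fermat's
    theorem for natural numbers applicable.\<close>
  define b where "b = nat (a mod int p)"
  have p: "int p > 0" using assms(1) prime_gt_0_nat by simp
  have b: "int b = a mod int p" using p by (simp add: b_def)
  have "\<not> p dvd b"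
    using assms(2) b by (metis dvd_mod_iff dvd_refl int_dvd_int_iff)
  then have "[b ^ (p - 1) = 1] (mod p)" using assms(1) by (rule fermat_theorem[rotated])
  then have "[int b ^ (p - 1) = 1] (mod int p)"
    by (metis cong_int_iff of_nat_1 of_nat_power)
  moreover have "[a ^ (p - 1) = int b ^ (p - 1)] (mod int p)"
    unfolding b by (intro cong_pow) (simp add: cong_def)
  ultimately have "[1 = a ^ (p - 1)] (mod int p)"
    using cong_trans cong_sym by blast
  then show ?thesis by (simp add: cong_iff_dvd_diff)
qed

text \<open>By Fermat, \<open>F S\<close> below is modulo \<open>p\<close> the indicator of \<open>S\<close> having sum zero, and its degree is
  smaller than \<open>card T\<close>.\<close>

lemma ex_zero_sum_subset:
  fixes g :: "'a \<Rightarrow> 'c::finite \<Rightarrow> int"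
  assumes "prime p" "finite T" "card T > CARD('c) * (p - 1)"
  shows "\<exists>S\<subseteq>T. S \<noteq> {} \<and> (\<forall>c. int p dvd (\<Sum>j\<in>S. g j c))"
proof (rule ccontr)
  assume contra: "\<not> ?thesis"
  \<comment> \<open>Both formulas follow the rules of \<open>set_polynomial\<close>: membership of
    \<open>j\<close> appears as a monomial of degree one, and subtraction as adding a multiple by
    \<open>- 1\<close>.\<close>
  define L where "L = (\<lambda>c S. \<Sum>j\<in>T. g j c * of_bool ({j} \<subseteq> S))"
  define F where "F = (\<lambda>S. \<Prod>c\<in>UNIV. 1 + (- 1) * L c S ^ (p - 1))"
  have p: "p > 1" using assms(1) prime_gt_1_nat by simp
  have L: "L c S = (\<Sum>j\<in>S. g j c)" if "S \<subseteq> T" for c S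
  proof -
    have "L c S = (\<Sum>j\<in>T. if j \<in> S then g j c else 0)"
      unfolding L_def by (intro sum.cong) auto
    also have "\<dots> = (\<Sum>j\<in>S. g j c)"
      using that assms(2) by (simp add: sum.If_cases Int_absorb1)
    finally show ?thesis .
  qed
  have "set_polynomial T 1 (L c)" for c
    unfolding L_def by (intro set_polynomial_sum set_polynomial.monomial) auto
  then have pow: "set_polynomial T (p - 1) (\<lambda>S. L c S ^ (p - 1))" for c
    using set_polynomial_power[of T 1 "L c" "p - 1"] assms(2) by simp
  have "set_polynomial T (p - 1) (\<lambda>S. 1 + (- 1) * L c S ^ (p - 1))" for c
    using set_polynomial_mult[OF set_polynomial_const[of T 0 "- 1"] pow[of c] assms(2)]
    by (intro set_polynomial.add set_polynomial_const) simp
  then have "set_polynomial T (CARD('c) * (p - 1)) F"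
    unfolding F_def using assms(2) by (intro set_polynomial_prod) auto
  then have zero: "(\<Sum>S\<in>Pow T. (- 1) ^ card S * F S) = 0"
    using assms by (intro alternating_sum_set_polynomial)
  have F_dvd: "int p dvd F S" if S: "S \<subseteq> T" "S \<noteq> {}" for S
  proof -
    obtain c where "\<not> int p dvd L c S" using contra L[OF S(1)] S by metis
    then have "int p dvd 1 + (- 1) * L c S ^ (p - 1)"
      using fermat_theorem_int[OF assms(1)] by simp
    also have "\<dots> dvd F S" unfolding F_def by (intro dvd_prodI) auto
    finally show ?thesis .
  qed
  \<comment> \<open>As \<open>p - 1\<close> is positive, the powers of zero vanish. The empty set
    thus gives the one term not divisible by \<open>p\<close> in an alternating sum that is
    zero.\<close>
  have "F {} = 1" using p by (simp add: F_def L_def power_0_left)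
  then have "(\<Sum>S\<in>Pow T. (- 1) ^ card S * F S)
      = 1 + (\<Sum>S\<in>Pow T - {{}}. (- 1) ^ card S * F S)"
    using assms(2) by (subst sum.remove[of _ "{}"]) auto
  moreover have "int p dvd (\<Sum>S\<in>Pow T - {{}}. (- 1) ^ card S * F S)"
    by (intro dvd_sum dvd_mult F_dvd) auto
  ultimately have "int p dvd 1" using zero
    by (metis dvd_0_right dvd_add_left_iff)
  then show False using p by simp
qed

text \<open>Each \<open>i\<close> is replaced by \<open>a i\<close> labelled copies, so that a
  family with repetitions becomes a set. The multiplicities are the sizes of the fibres
  \<open>B i\<close> of a zero-sum subset.\<close>

lemma ex_zero_sum_multiplicities:
  fixes v :: "'i \<Rightarrow> 'c::finite \<Rightarrow> int" and a :: "'i \<Rightarrow> nat"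
  assumes "prime p" "finite I" "(\<Sum>i\<in>I. a i) > CARD('c) * (p - 1)"
  shows "\<exists>b. (\<forall>i\<in>I. b i \<le> a i) \<and> (\<exists>i\<in>I. b i \<noteq> 0) \<and>
    (\<forall>c. int p dvd (\<Sum>i\<in>I. int (b i) * v i c))"
proof -
  define J where "J = (SIGMA i:I. {..<a i})"
  have "finite J" "card J = (\<Sum>i\<in>I. a i)" using assms(2) by (auto simp: J_def)
  then obtain S where S: "S \<subseteq> J" "S \<noteq> {}" "\<And>c. int p dvd (\<Sum>j\<in>S. v (fst j) c)"
    using ex_zero_sum_subset[of p J "\<lambda>j. v (fst j)"] assms by auto
  define B where "B = (\<lambda>i. {l. (i, l) \<in> S})"
  have B: "B i \<subseteq> {..<a i}" for i using S(1) by (auto simp: B_def J_def)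
  then have fin: "finite (B i)" for i using finite_subset by blast
  have SB: "S = (SIGMA i:I. B i)" using S(1) by (auto simp: B_def J_def)
  have "(\<Sum>j\<in>S. v (fst j) c) = (\<Sum>i\<in>I. int (card (B i)) * v i c)" for c
    unfolding SB
    using sum.Sigma[of I B "\<lambda>i l. v i c"] assms(2) fin by (simp add: split_def)
  then have "\<And>c. int p dvd (\<Sum>i\<in>I. int (card (B i)) * v i c)" using S(3) by simp
  moreover have "card (B i) \<le> a i" for i
    using card_mono[OF _ B[of i]] by simp
  moreover have "\<exists>i\<in>I. card (B i) \<noteq> 0" using S(2) SB fin by fastforce
  ultimately show ?thesis by (intro exI[of _ "\<lambda>i. card (B i)"]) blast
qed

section \<open>Integral combinations with denominator \<open>p\<close>\<close>

lemma ex_fractional_combination: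
  fixes u :: "'i \<Rightarrow> real ^ 'd" and \<alpha> :: "'i \<Rightarrow> real"
  assumes "prime p" "finite I"
    and u: "\<And>i. i \<in> I \<Longrightarrow> u i \<in> int_vectors"
    and \<alpha>: "\<And>i. i \<in> I \<Longrightarrow> \<alpha> i \<ge> 0"
    and sum: "(\<Sum>i\<in>I. \<alpha> i) \<ge> real CARD('d)"
  shows "\<exists>\<beta>. (\<forall>i\<in>I. 0 \<le> \<beta> i \<and> \<beta> i \<le> \<alpha> i + 1 / real p \<and> (\<alpha> i = 0 \<longrightarrow> \<beta> i = 0)) \<and>
    (\<exists>i\<in>I. \<beta> i \<noteq> 0) \<and> (\<Sum>i\<in>I. \<beta> i *\<^sub>R u i) \<in> int_vectors"
proof -
  define a where "a = (\<lambda>i. nat \<lceil>real p * \<alpha> i\<rceil>)"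
  define v where "v = (\<lambda>i c. \<lfloor>u i $ c\<rfloor>)"
  have p: "p > 1" using assms(1) prime_gt_1_nat by simp
  have v: "real_of_int (v i c) = u i $ c" if "i \<in> I" for i c
    using u[OF that] by (simp add: v_def int_vectors_def)
  have a: "real p * \<alpha> i \<le> real (a i)" "real (a i) \<le> real p * \<alpha> i + 1" if "i \<in> I" for i
    using \<alpha>[OF that] by (auto simp: a_def)
  have "real CARD('d) * real p \<le> real p * (\<Sum>i\<in>I. \<alpha> i)"
    using sum by (metis mult.commute mult_left_mono of_nat_0_le_iff)
  also have "\<dots> \<le> real (\<Sum>i\<in>I. a i)"
    unfolding sum_distrib_left of_nat_sum by (intro sum_mono a)
  finally have "CARD('d) * p \<le> (\<Sum>i\<in>I. a i)"
    by (metis of_nat_le_iff of_nat_mult)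
  moreover have "CARD('d) * (p - 1) < CARD('d) * p" using p by simp
  ultimately have "(\<Sum>i\<in>I. a i) > CARD('d) * (p - 1)" by linarith
  then obtain b where b: "\<And>i. i \<in> I \<Longrightarrow> b i \<le> a i" "\<exists>i\<in>I. b i \<noteq> 0"
      "\<And>c. int p dvd (\<Sum>i\<in>I. int (b i) * v i c)"
    using ex_zero_sum_multiplicities[of p I a v] assms(1,2) by auto
  define \<beta> where "\<beta> = (\<lambda>i. real (b i) / real p)"
  have "0 \<le> \<beta> i \<and> \<beta> i \<le> \<alpha> i + 1 / real p \<and> (\<alpha> i = 0 \<longrightarrow> \<beta> i = 0)" if "i \<in> I" for i
  proof -
    have "real (b i) \<le> real p * \<alpha> i + 1"
      using a(2)[OF that] b(1)[OF that] by linarith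
    then have "\<beta> i \<le> \<alpha> i + 1 / real p" using p by (simp add: \<beta>_def field_simps)
    \<comment> \<open>Rounding up zero yields no copies. The later scaling depends on this: no
      positive factor could bring a positive coefficient below a zero bound.\<close>
    moreover have "\<beta> i = 0" if "\<alpha> i = 0"
      using b(1)[OF \<open>i \<in> I\<close>] that by (simp add: \<beta>_def a_def)
    ultimately show ?thesis by (simp add: \<beta>_def)
  qed
  moreover have "\<exists>i\<in>I. \<beta> i \<noteq> 0" using b(2) p by (simp add: \<beta>_def)
  moreover have "(\<Sum>i\<in>I. \<beta> i *\<^sub>R u i) $ c \<in> \<int>" for c
  proof -
    obtain z where z: "(\<Sum>i\<in>I. int (b i) * v i c) = int p * z" using b(3) by blast
    have "(\<Sum>i\<in>I. \<beta> i *\<^sub>R u i) $ c = (\<Sum>i\<in>I. real (b i) * v i c) / real p"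
      by (simp add: \<beta>_def v sum_divide_distrib)
    also have "(\<Sum>i\<in>I. real (b i) * v i c) = real_of_int (\<Sum>i\<in>I. int (b i) * v i c)" by simp
    also have "\<dots> / real p = of_int z" unfolding z using p by simp
    finally show ?thesis by simp
  qed
  ultimately show ?thesis unfolding int_vectors_def by blast
qed

section \<open>Tools for the limit and for scaling\<close>

lemma closed_int_vectors: "closed (int_vectors :: (real ^ 'n) set)"
  unfolding int_vectors_def
  by (intro closed_Collect_all closed_vimage[of \<int>, unfolded vimage_def] continuous_intros) auto

lemma norm_int_vector_ge_1:
  assumes "x \<in> int_vectors" "x \<noteq> 0"
  shows "norm x \<ge> 1"
proof -
  obtain j where "x $ j \<noteq> 0" using assms(2) by (auto simp: vec_eq_iff)
  then have "1 \<le> \<bar>x $ j\<bar>" using assms(1) by (auto simp: int_vectors_def intro: Ints_nonzero_abs_ge1)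
  also have "\<dots> \<le> norm x" by (rule component_le_norm_cart)
  finally show ?thesis .
qed

text \<open>The box is compact by Tychonoff's theorem. Countability of the index type makes the
  product topology metrizable, so compactness gives sequential compactness.\<close>

lemma ex_subseq_pointwise_convergent:
  fixes \<beta> :: "nat \<Rightarrow> 'i::countable \<Rightarrow> real"
  assumes "\<And>n i. \<beta> n i \<in> {l i..h i}"
  shows "\<exists>\<gamma> r. strict_mono r \<and> (\<forall>i. (\<lambda>n. \<beta> (r n) i) \<longlonglongrightarrow> \<gamma> i)"
proof -
  have "compactin (product_topology (\<lambda>_. euclidean) UNIV) (PiE UNIV (\<lambda>i. {l i..h i}))"
    by (simp add: compactin_PiE)
  then have "compact (PiE UNIV (\<lambda>i. {l i..h i}))"
    by (simp add: euclidean_product_topology)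
  then have "seq_compact (PiE UNIV (\<lambda>i. {l i..h i}))"
    by (simp add: compact_eq_seq_compact_metric)
  moreover have "\<forall>n. \<beta> n \<in> PiE UNIV (\<lambda>i. {l i..h i})" using assms by auto
  ultimately obtain \<gamma> r where r: "strict_mono r" "(\<beta> \<circ> r) \<longlonglongrightarrow> \<gamma>"
    unfolding seq_compact_def by blast
  have "(\<lambda>n. \<beta> (r n) i) \<longlonglongrightarrow> \<gamma> i" for i
  proof -
    have "isCont (\<lambda>f. f i) \<gamma>"
      by (rule continuous_on_interior[OF continuous_on_product_coordinates]) simp
    from isCont_tendsto_compose[OF this r(2)] show ?thesis by (simp add: comp_def)
  qed
  with r(1) show ?thesis by blast
qed

text \<open>Only indices with \<open>\<beta> i > 0\<close> constrain \<open>t\<close>. There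
  \<open>\<alpha> i\<close> is positive too, so \<open>\<alpha> i / \<beta> i\<close> is a positive
  admissible factor, and finitely many such factors have a positive minimum.\<close>

lemma ex_scaled_below:
  fixes \<alpha> \<beta> :: "'i \<Rightarrow> real"
  assumes "finite I" "\<And>i. i \<in> I \<Longrightarrow> \<alpha> i \<ge> 0" "\<And>i. i \<in> I \<Longrightarrow> \<alpha> i = 0 \<Longrightarrow> \<beta> i = 0"
  shows "\<exists>t>0. \<forall>i\<in>I. t * \<beta> i \<le> \<alpha> i"
  using assms
proof (induction I)
  case empty
  then show ?case by (auto intro: exI[of _ 1])
next
  case (insert j I)
  then obtain t where t: "t > 0" "\<And>i. i \<in> I \<Longrightarrow> t * \<beta> i \<le> \<alpha> i" by auto
  obtain s where s: "s > 0" "s * \<beta> j \<le> \<alpha> j"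
  proof (cases "\<beta> j \<le> 0")
    case True
    then have "1 * \<beta> j \<le> \<alpha> j" using insert.prems(1)[of j] by simp
    then show ?thesis using that[of 1] by simp
  next
    case False
    then have "\<alpha> j > 0" using insert.prems(1,2)[of j] by force
    then show ?thesis using False that[of "\<alpha> j / \<beta> j"] by simp
  qed
  have "min s t * \<beta> i \<le> \<alpha> i" if "i \<in> insert j I" for i
  proof (cases "\<beta> i \<le> 0")
    case True
    then have "min s t * \<beta> i \<le> 0" using s t by (simp add: mult_nonneg_nonpos)
    then show ?thesis using insert.prems(1)[OF that] by linarith
  next
    case False
    then have "min s t * \<beta> i \<le> s * \<beta> i" "min s t * \<beta> i \<le> t * \<beta> i"
      by (auto intro!: mult_right_mono)
    then show ?thesis using s t that by fastforce
  qed
  then show ?case using s(1) t(1) by (intro exI[of _ "min s t"]) auto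
qed

section \<open>Scaling or passing to the limit\<close>

theorem lemma1:
  fixes k :: nat
    and u :: "nat \<Rightarrow> real ^ 'd"
    and \<alpha> :: "nat \<Rightarrow> real"
  assumes "k \<ge> 1"
    and "\<And>i. i \<in> {1..k} \<Longrightarrow> u i \<in> int_vectors"
    and "\<And>i. i \<in> {1..k} \<Longrightarrow> \<alpha> i \<ge> 0"
    and "(\<Sum>i=1..k. \<alpha> i) \<ge> real CARD('d)"
  shows "\<exists>\<beta> :: nat \<Rightarrow> real.
           (\<forall>i\<in>{1..k}. \<beta> i \<in> {0..\<alpha> i}) \<and>
           (\<exists>i\<in>{1..k}. \<beta> i \<noteq> 0) \<and>
           (\<Sum>i=1..k. \<beta> i *\<^sub>R u i) \<in> int_vectors"
proof -
  \<comment> \<open>The error is stated with \<open>Suc n\<close> instead of a prime, so that every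
    \<open>n\<close> indexes an approximation; a prime above \<open>Suc n\<close> gives a smaller
    error.\<close>
  define P where "P = (\<lambda>n \<beta>.
    (\<forall>i\<in>{1..k}. 0 \<le> \<beta> i \<and> \<beta> i \<le> \<alpha> i + 1 / real (Suc n) \<and> (\<alpha> i = 0 \<longrightarrow> \<beta> i = 0)) \<and>
    (\<exists>i\<in>{1..k}. \<beta> i \<noteq> 0) \<and> (\<Sum>i=1..k. \<beta> i *\<^sub>R u i) \<in> int_vectors)"
  have "\<exists>\<beta>. P n \<beta>" for n
  proof -
    obtain p where p: "prime p" "Suc n < p" using bigger_prime by blast
    have "1 / real p \<le> 1 / real (Suc n)" using p(2) by (intro divide_left_mono) auto
    then show ?thesis
      using ex_fractional_combination[OF p(1), of "{1..k}" u \<alpha>] assms(2-4)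
      unfolding P_def by (smt (verit) finite_atLeastAtMost)
  qed
  then obtain \<beta> where \<beta>: "\<And>n. P n (\<beta> n)" by metis
  show ?thesis
  proof (cases "\<exists>n. (\<Sum>i=1..k. \<beta> n i *\<^sub>R u i) = 0")
    case True
    then obtain n where n: "(\<Sum>i=1..k. \<beta> n i *\<^sub>R u i) = 0" by blast
    obtain t where t: "t > 0" "\<And>i. i \<in> {1..k} \<Longrightarrow> t * \<beta> n i \<le> \<alpha> i"
      using ex_scaled_below[of "{1..k}" \<alpha> "\<beta> n"] \<beta>[of n] assms(3) unfolding P_def by auto
    \<comment> \<open>Scaling by an arbitrary \<open>t\<close> preserves integrality here because
      the combination is zero.\<close>
    have "(\<Sum>i=1..k. (t * \<beta> n i) *\<^sub>R u i) = 0"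
      using n by (simp flip: scaleR_scaleR scaleR_sum_right)
    then show ?thesis
      using t \<beta>[of n] unfolding P_def
      by (intro exI[of _ "\<lambda>i. t * \<beta> n i"]) (auto simp: int_vectors_def)
  next
    case False
    \<comment> \<open>The compactness lemma needs bounds at every natural index, hence the extension
      by zero. Outside the range the sign of \<open>\<alpha> i\<close> is unknown, and the absolute
      value keeps zero inside the interval.\<close>
    define \<beta>' where "\<beta>' = (\<lambda>n i. if i \<in> {1..k} then \<beta> n i else 0)"
    have "\<beta>' n i \<in> {0..\<bar>\<alpha> i\<bar> + 1}" for n i
    proof (cases "i \<in> {1..k}")
      case True
      have "1 / real (Suc n) \<le> 1" by simp
      moreover have "0 \<le> \<beta> n i" "\<beta> n i \<le> \<alpha> i + 1 / real (Suc n)"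
        using \<beta>[of n] True unfolding P_def by auto
      ultimately have "0 \<le> \<beta> n i" "\<beta> n i \<le> \<bar>\<alpha> i\<bar> + 1" by linarith+
      then show ?thesis using True by (simp add: \<beta>'_def)
    qed (auto simp: \<beta>'_def)
    from ex_subseq_pointwise_convergent[of \<beta>', OF this] obtain \<gamma> r
      where r: "strict_mono r" "\<And>i. (\<lambda>n. \<beta>' (r n) i) \<longlonglongrightarrow> \<gamma> i" by blast
    have lim: "(\<lambda>n. \<beta> (r n) i) \<longlonglongrightarrow> \<gamma> i" if "i \<in> {1..k}" for i
      using r(2)[of i] that by (simp add: \<beta>'_def)
    let ?x = "\<lambda>n. \<Sum>i=1..k. \<beta> (r n) i *\<^sub>R u i"
    have x: "?x \<longlonglongrightarrow> (\<Sum>i=1..k. \<gamma> i *\<^sub>R u i)"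
      by (intro tendsto_intros lim)
    have int: "?x n \<in> int_vectors" for n using \<beta>[of "r n"] unfolding P_def by blast
    have "(\<Sum>i=1..k. \<gamma> i *\<^sub>R u i) \<in> int_vectors"
      using closed_sequentially[OF closed_int_vectors _ x] int by blast
    moreover have "norm (?x n) \<ge> 1" for n
      using norm_int_vector_ge_1[OF int] False by blast
    then have "norm (\<Sum>i=1..k. \<gamma> i *\<^sub>R u i) \<ge> 1"
      by (intro LIMSEQ_le_const[OF tendsto_norm[OF x]]) auto
    then have "\<exists>i\<in>{1..k}. \<gamma> i \<noteq> 0" by (auto intro: ccontr simp: sum.neutral)
    moreover have "\<gamma> i \<in> {0..\<alpha> i}" if i: "i \<in> {1..k}" for i
    proof -
      have b: "0 \<le> \<beta> (r n) i" "\<beta> (r n) i \<le> \<alpha> i + 1 / real (Suc (r n))" for n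
        using \<beta>[of "r n"] i unfolding P_def by auto
      \<comment> \<open>The error tends to zero, also along the subsequence \<open>r\<close>, so the
        limit satisfies the exact upper bound.\<close>
      have "(\<lambda>n. \<alpha> i + 1 / real (Suc n)) \<longlonglongrightarrow> \<alpha> i + 0"
        by (intro tendsto_intros LIMSEQ_Suc[OF lim_1_over_n])
      from LIMSEQ_subseq_LIMSEQ[OF this r(1)]
      have "(\<lambda>n. \<alpha> i + 1 / real (Suc (r n))) \<longlonglongrightarrow> \<alpha> i" by (simp add: comp_def)
      then have "\<gamma> i \<le> \<alpha> i" using b(2) by (intro LIMSEQ_le[OF lim[OF i]]) auto
      moreover have "0 \<le> \<gamma> i" using b(1) by (intro LIMSEQ_le_const[OF lim[OF i]]) auto
      ultimately show ?thesis by simp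
    qed
    ultimately show ?thesis by blast
  qed
qed

end
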